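(* Let $\mathcal M:\ \mathbf z=\mathbf z(x,y)$, $(x,y)\in\mathcal D$, be a maximal strongly regular space-like surface in $\mathbb R^3_1$ (in the sense of the context) whose parametric net is principal, with normal curvature function $\nu=\nu_1>0$. Then there exist locally (i.e. in a neighborhood of every point of $\mathcal D$) principal parameters $(\bar x,\bar y)$ such that $$\mathbf z_{\bar x}^2=-\mathbf z_{\bar y}^2=\frac1\nu .$$
   Context: $\mathbb R^3_1$ is $\mathbb R^3$ with the inner product $\langle a,b\rangle=a_1b_1+a_2b_2-a_3b_3$, and $a^2:=\langle a,a\rangle$. Everything is smooth. Subscripts denote partial derivatives. A space-like surface (the name refers to the causal character of its normal) is an immersion $\mathbf z:\mathcal D\to\mathbb R^3_1$ of a domain $\mathcal D\subset\mathbb R^2$ with $E=\mathbf z_x^2>0$, $G=\mathbf z_y^2<0$ and unit normal $l$ with $l^2=1$. Put $F=\langle\mathbf z_x,\mathbf z_y\rangle$, $e=\langle\mathbf z_{xx},l\rangle$, $f=\langle\mathbf z_{xy},l\rangle$, $g=\langle\mathbf z_{yy},l\rangle$. Surfaces have no umbilical points; parameters are principal (the parametric net is principal) if $F=f=0$. In principal parameters, put $$\nu_1=\frac eE,\quad \nu_2=\frac gG,\quad \gamma_1=\frac{E_y}{2E\sqrt{-G}},\quad \gamma_2=-\frac{G_x}{2\sqrt E\,G}$$ (principal curvatures and principal geodesic curvatures). The unit normal $l$ is chosen so that $\nu_1-\nu_2>0$ (and $\mathbb R^3_1$ is oriented so that $(\mathbf z_x,\mathbf z_y,l)$ is positively oriented).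 The surface is strongly regular if $\gamma_1\gamma_2\neq0$ on $\mathcal D$, and maximal if $\nu_1+\nu_2=0$; then $\nu:=\nu_1>0$ is called the normal curvature function. *)

theory Defs
  imports "HOL-Analysis.Analysis"
begin

(* Meant for open S: f is n times Frechet differentiable on S and all its n-fold
   directional derivatives are continuous, i.e. f is of class C^n on S. *)
primrec higher_differentiable_on ::
    "'a::real_normed_vector set \<Rightarrow> ('a \<Rightarrow> 'b::real_normed_vector) \<Rightarrow> nat \<Rightarrow> bool" where
  "higher_differentiable_on S f 0 \<longleftrightarrow> continuous_on S f"
| "higher_differentiable_on S f (Suc n) \<longleftrightarrow>
     (\<forall>x\<in>S. f differentiable (at x)) \<and>
     (\<forall>v. higher_differentiable_on S (\<lambda>x. frechet_derivative f (at x) v) n)"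

definition smooth_on ::
    "'a::real_normed_vector set \<Rightarrow> ('a \<Rightarrow> 'b::real_normed_vector) \<Rightarrow> bool" where
  "smooth_on S f \<longleftrightarrow> (\<forall>n. higher_differentiable_on S f n)"

definition diffeomorphism ::
    "'a::real_normed_vector set \<Rightarrow> 'b::real_normed_vector set \<Rightarrow> ('a \<Rightarrow> 'b) \<Rightarrow> ('b \<Rightarrow> 'a) \<Rightarrow> bool" where
  "diffeomorphism U V \<phi> \<psi> \<longleftrightarrow>
     open U \<and> open V \<and> homeomorphism U V \<phi> \<psi> \<and> smooth_on U \<phi> \<and> smooth_on V \<psi>"

definition partial_x :: "(real \<times> real \<Rightarrow> 'b::real_normed_vector) \<Rightarrow> real \<times> real \<Rightarrow> 'b" where
  "partial_x h p = vector_derivative (\<lambda>t. h (t, snd p)) (at (fst p))"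

definition partial_y :: "(real \<times> real \<Rightarrow> 'b::real_normed_vector) \<Rightarrow> real \<times> real \<Rightarrow> 'b" where
  "partial_y h p = vector_derivative (\<lambda>t. h (fst p, t)) (at (snd p))"

definition mink :: "real^3 \<Rightarrow> real^3 \<Rightarrow> real" where
  "mink a b = a$1 * b$1 + a$2 * b$2 - a$3 * b$3"

definition coeff_E :: "(real \<times> real \<Rightarrow> real^3) \<Rightarrow> real \<times> real \<Rightarrow> real" where
  "coeff_E z p = mink (partial_x z p) (partial_x z p)"

definition coeff_F :: "(real \<times> real \<Rightarrow> real^3) \<Rightarrow> real \<times> real \<Rightarrow> real" where
  "coeff_F z p = mink (partial_x z p) (partial_y z p)"

definition coeff_G :: "(real \<times> real \<Rightarrow> real^3) \<Rightarrow> real \<times> real \<Rightarrow> real" where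
  "coeff_G z p = mink (partial_y z p) (partial_y z p)"

definition coeff_e :: "(real \<times> real \<Rightarrow> real^3) \<Rightarrow> (real \<times> real \<Rightarrow> real^3) \<Rightarrow> real \<times> real \<Rightarrow> real" where
  "coeff_e z l p = mink (partial_x (partial_x z) p) (l p)"

definition coeff_f :: "(real \<times> real \<Rightarrow> real^3) \<Rightarrow> (real \<times> real \<Rightarrow> real^3) \<Rightarrow> real \<times> real \<Rightarrow> real" where
  "coeff_f z l p = mink (partial_y (partial_x z) p) (l p)"

definition coeff_g :: "(real \<times> real \<Rightarrow> real^3) \<Rightarrow> (real \<times> real \<Rightarrow> real^3) \<Rightarrow> real \<times> real \<Rightarrow> real" where
  "coeff_g z l p = mink (partial_y (partial_y z) p) (l p)"

(* A point is umbilical if the second fundamental form is proportional to the first. *)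
definition umbilical ::
    "(real \<times> real \<Rightarrow> real^3) \<Rightarrow> (real \<times> real \<Rightarrow> real^3) \<Rightarrow> real \<times> real \<Rightarrow> bool" where
  "umbilical z l p \<longleftrightarrow>
     (\<exists>c. coeff_e z l p = c * coeff_E z p \<and> coeff_f z l p = c * coeff_F z p \<and>
          coeff_g z l p = c * coeff_G z p)"

(* "Space-like" refers to the normal l; the induced metric is Lorentzian. *)
definition spacelike_surface ::
    "(real \<times> real) set \<Rightarrow> (real \<times> real \<Rightarrow> real^3) \<Rightarrow> (real \<times> real \<Rightarrow> real^3) \<Rightarrow> bool" where
  "spacelike_surface D z l \<longleftrightarrow>
     open D \<and> connected D \<and> D \<noteq> {} \<and> smooth_on D z \<and> smooth_on D l \<and>
     (\<forall>p\<in>D. inj (frechet_derivative z (at p)) \<and>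
        coeff_E z p > 0 \<and> coeff_G z p < 0 \<and>
        mink (l p) (l p) = 1 \<and> mink (l p) (partial_x z p) = 0 \<and> mink (l p) (partial_y z p) = 0 \<and>
        \<not> umbilical z l p)"

definition principal_net ::
    "(real \<times> real) set \<Rightarrow> (real \<times> real \<Rightarrow> real^3) \<Rightarrow> (real \<times> real \<Rightarrow> real^3) \<Rightarrow> bool" where
  "principal_net D z l \<longleftrightarrow> (\<forall>p\<in>D. coeff_F z p = 0 \<and> coeff_f z l p = 0)"

definition nu1 :: "(real \<times> real \<Rightarrow> real^3) \<Rightarrow> (real \<times> real \<Rightarrow> real^3) \<Rightarrow> real \<times> real \<Rightarrow> real" where
  "nu1 z l p = coeff_e z l p / coeff_E z p"

definition nu2 :: "(real \<times> real \<Rightarrow> real^3) \<Rightarrow> (real \<times> real \<Rightarrow> real^3) \<Rightarrow> real \<times> real \<Rightarrow> real" where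
  "nu2 z l p = coeff_g z l p / coeff_G z p"

definition gamma1 :: "(real \<times> real \<Rightarrow> real^3) \<Rightarrow> real \<times> real \<Rightarrow> real" where
  "gamma1 z p = partial_y (coeff_E z) p / (2 * coeff_E z p * sqrt (- coeff_G z p))"

definition gamma2 :: "(real \<times> real \<Rightarrow> real^3) \<Rightarrow> real \<times> real \<Rightarrow> real" where
  "gamma2 z p = - (partial_x (coeff_G z) p / (2 * sqrt (coeff_E z p) * coeff_G z p))"

(* An orientation of the ambient space is represented by a nonzero real w: a basis is
   positively oriented if its determinant has the sign of w. *)
definition normal_convention ::
    "real \<Rightarrow> (real \<times> real) set \<Rightarrow> (real \<times> real \<Rightarrow> real^3) \<Rightarrow> (real \<times> real \<Rightarrow> real^3) \<Rightarrow> bool" where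
  "normal_convention w D z l \<longleftrightarrow>
     (\<forall>p\<in>D. nu1 z l p - nu2 z l p > 0 \<and>
        w * det (vector [partial_x z p, partial_y z p, l p] :: real^3^3) > 0)"

definition principal_surface ::
    "real \<Rightarrow> (real \<times> real) set \<Rightarrow> (real \<times> real \<Rightarrow> real^3) \<Rightarrow> (real \<times> real \<Rightarrow> real^3) \<Rightarrow> bool" where
  "principal_surface w D z l \<longleftrightarrow>
     spacelike_surface D z l \<and> principal_net D z l \<and> normal_convention w D z l"

definition strongly_regular :: "(real \<times> real) set \<Rightarrow> (real \<times> real \<Rightarrow> real^3) \<Rightarrow> bool" where
  "strongly_regular D z \<longleftrightarrow> (\<forall>p\<in>D. gamma1 z p * gamma2 z p \<noteq> 0)"

definition maximal ::
    "(real \<times> real) set \<Rightarrow> (real \<times> real \<Rightarrow> real^3) \<Rightarrow> (real \<times> real \<Rightarrow> real^3) \<Rightarrow> bool" where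
  "maximal D z l \<longleftrightarrow> (\<forall>p\<in>D. nu1 z l p + nu2 z l p = 0)"

end

theory Submission
  imports Defs
begin

text \<open>For a maximal surface in principal parameters one of the Codazzi equations states
  that $e = \<nu> E$ does not depend on $y$, the other that $g = - \<nu> G$ does not depend on $x$.
  Hence $dX = \sqrt{e} dx$ and $dY = \sqrt{g} dy$ define new principal
  parameters locally, and in these $z_X^2 = E / e = 1 / \<nu>$ and
  $z_Y^2 = G / g = - 1 / \<nu>$.\<close>

subsection \<open>Calculus of smooth functions\<close>

text \<open>In principal parameters the Codazzi equations read e_y = (nu1 + nu2) E_y / 2 and g_x =
  (nu1 + nu2) G_x / 2, because the Weingarten formulas turn each of the two terms of the derivative
  into a principal curvature times half a derivative of the metric. Maximality makes the curvatures
  cancel.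

  The square roots are smooth because e = \<nu> E and g = -\<nu> G are both positive: \<nu> > 0, and
  the Lorentzian signs are E > 0 > G. Since e depends on x alone and g on y alone, the change of
  parameters is a product of two functions of one variable. Monotonicity and the one-dimensional
  inverse function theorem therefore suffice, and the parametric net is kept. Both factors are
  increasing, so the same normal \<open>l\<close> and the same orientation sign \<open>w\<close>
  serve the new parameters.

  Smoothness means class C^n for every n, defined by recursion on derivatives in fixed directions.
  Each closure property is thus an induction on n that feeds an explicit derivative formula back
  into the induction hypothesis.\<close>

lemma higher_differentiable_on_imp_continuous_on:
  "higher_differentiable_on S f n \<Longrightarrow> continuous_on S f"
  by (cases n) (auto intro!: continuous_at_imp_continuous_on differentiable_imp_continuous_within)

lemma higher_differentiable_on_SucD:
  "higher_differentiable_on S f (Suc n) \<Longrightarrow> higher_differentiable_on S f n"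
proof (induction n arbitrary: f)
  case 0
  then show ?case using higher_differentiable_on_imp_continuous_on[OF 0] by simp
next
  case (Suc n)
  then show ?case by (metis higher_differentiable_on.simps(2))
qed

text \<open>The derivatives are taken in the whole space, so agreement on \<open>S\<close> must mean
  agreement near each of its points; this is where openness enters.\<close>

lemma higher_differentiable_on_cong:
  assumes "open S" and "\<And>x. x \<in> S \<Longrightarrow> f x = g x"
  shows "higher_differentiable_on S f n \<longleftrightarrow> higher_differentiable_on S g n"
  using assms(2)
proof (induction n arbitrary: f g)
  case 0
  then show ?case by (simp cong: continuous_on_cong)
next
  case (Suc n)
  have diff: "f differentiable at x \<longleftrightarrow> g differentiable at x" if "x \<in> S" for x
    unfolding differentiable_def
    using has_derivative_transform_within_open[OF _ \<open>open S\<close> that] Suc.prems by metis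
  have eq: "frechet_derivative f (at x) = frechet_derivative g (at x)" if "x \<in> S" for x
  proof -
    have "(f has_derivative F) (at x) \<longleftrightarrow> (g has_derivative F) (at x)" for F
      using has_derivative_transform_within_open[OF _ \<open>open S\<close> that] Suc.prems by metis
    then show ?thesis by (simp add: frechet_derivative_def)
  qed
  have "higher_differentiable_on S (\<lambda>x. frechet_derivative f (at x) v) n \<longleftrightarrow>
        higher_differentiable_on S (\<lambda>x. frechet_derivative g (at x) v) n" for v
    using eq by (intro Suc.IH) simp
  with diff show ?case by auto
qed

text \<open>Uniqueness of the derivative lets any explicit formula replace the chosen
  \<open>frechet_derivative\<close>. All inductions on the order below go through this rule.\<close>

lemma higher_differentiable_on_SucI:
  assumes "open S" and "\<And>x. x \<in> S \<Longrightarrow> (f has_derivative f' x) (at x)"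
    and "\<And>v. higher_differentiable_on S (\<lambda>x. f' x v) n"
  shows "higher_differentiable_on S f (Suc n)"
proof -
  have "higher_differentiable_on S (\<lambda>x. frechet_derivative f (at x) v) n \<longleftrightarrow>
        higher_differentiable_on S (\<lambda>x. f' x v) n" for v
    using frechet_derivative_at[OF assms(2)]
    by (intro higher_differentiable_on_cong[OF assms(1)]) metis
  with assms show ?thesis by (auto simp: differentiable_def)
qed

lemma higher_differentiable_on_has_derivative:
  "higher_differentiable_on S f (Suc n) \<Longrightarrow> x \<in> S \<Longrightarrow>
   (f has_derivative frechet_derivative f (at x)) (at x)"
  by (simp add: frechet_derivative_works[symmetric])

lemma higher_differentiable_on_const: "higher_differentiable_on S (\<lambda>x. c) n"
  by (induction n arbitrary: c) auto

lemma higher_differentiable_on_add: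
  assumes "open S" "higher_differentiable_on S f n" "higher_differentiable_on S g n"
  shows "higher_differentiable_on S (\<lambda>x. f x + g x) n"
  using assms(2,3)
proof (induction n arbitrary: f g)
  case 0
  then show ?case by (auto intro: continuous_intros)
next
  case (Suc n)
  show ?case
  proof (rule higher_differentiable_on_SucI[OF assms(1)])
    fix x assume "x \<in> S"
    then show "((\<lambda>x. f x + g x) has_derivative
       (\<lambda>v. frechet_derivative f (at x) v + frechet_derivative g (at x) v)) (at x)"
      by (intro has_derivative_add higher_differentiable_on_has_derivative[OF Suc.prems(1)]
          higher_differentiable_on_has_derivative[OF Suc.prems(2)])
  next
    fix v
    show "higher_differentiable_on S
            (\<lambda>x. frechet_derivative f (at x) v + frechet_derivative g (at x) v) n"
      using Suc.prems by (intro Suc.IH) auto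
  qed
qed

lemma higher_differentiable_on_sum:
  assumes "open S" "\<And>i. i \<in> I \<Longrightarrow> higher_differentiable_on S (f i) n"
  shows "higher_differentiable_on S (\<lambda>x. \<Sum>i\<in>I. f i x) n"
  using assms(2)
  by (induction I rule: infinite_finite_induct)
    (auto intro: higher_differentiable_on_const higher_differentiable_on_add[OF assms(1)])

text \<open>Leibniz rule. Each summand pairs a derivative with an undifferentiated factor, whose
  order is lowered by one so that the induction hypothesis applies to both. Instances used later are
  multiplication, scaling and \<open>mink\<close>.\<close>

lemma (in bounded_bilinear) higher_differentiable_on_bilinear:
  assumes "open S" "higher_differentiable_on S f n" "higher_differentiable_on S g n"
  shows "higher_differentiable_on S (\<lambda>x. prod (f x) (g x)) n"
  using assms(2,3)
proof (induction n arbitrary: f g)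
  case 0
  then show ?case by (auto intro: continuous_on)
next
  case (Suc n)
  show ?case
  proof (rule higher_differentiable_on_SucI[OF assms(1)])
    fix x assume "x \<in> S"
    then show "((\<lambda>x. prod (f x) (g x)) has_derivative
       (\<lambda>v. prod (f x) (frechet_derivative g (at x) v) +
            prod (frechet_derivative f (at x) v) (g x))) (at x)"
      by (intro FDERIV higher_differentiable_on_has_derivative[OF Suc.prems(1)]
          higher_differentiable_on_has_derivative[OF Suc.prems(2)])
  next
    fix v
    show "higher_differentiable_on S
       (\<lambda>x. prod (f x) (frechet_derivative g (at x) v) +
            prod (frechet_derivative f (at x) v) (g x)) n"
      using Suc.prems Suc.prems[THEN higher_differentiable_on_SucD]
      by (intro higher_differentiable_on_add[OF assms(1)] Suc.IH) auto
  qed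
qed

lemma (in bounded_linear) higher_differentiable_on_linear:
  assumes "open S" "higher_differentiable_on S g n"
  shows "higher_differentiable_on S (\<lambda>x. f (g x)) n"
  using assms(2)
proof (induction n arbitrary: g)
  case 0
  then show ?case by (auto intro: continuous_on)
next
  case (Suc n)
  show ?case
  proof (rule higher_differentiable_on_SucI[OF assms(1)])
    fix x assume "x \<in> S"
    then show "((\<lambda>x. f (g x)) has_derivative (\<lambda>v. f (frechet_derivative g (at x) v))) (at x)"
      by (intro has_derivative higher_differentiable_on_has_derivative[OF Suc.prems])
  next
    fix v
    show "higher_differentiable_on S (\<lambda>x. f (frechet_derivative g (at x) v)) n"
      using Suc.prems by (intro Suc.IH) auto
  qed
qed

lemma higher_differentiable_on_ident:
  assumes "open S"
  shows "higher_differentiable_on S (\<lambda>x. x) n"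
proof (cases n)
  case (Suc m)
  show ?thesis unfolding Suc
    by (rule higher_differentiable_on_SucI[OF assms has_derivative_ident])
      (rule higher_differentiable_on_const)
qed auto

lemma higher_differentiable_on_Pair:
  assumes "open S" "higher_differentiable_on S f n" "higher_differentiable_on S g n"
  shows "higher_differentiable_on S (\<lambda>x. (f x, g x)) n"
  using assms(2,3)
proof (induction n arbitrary: f g)
  case 0
  then show ?case by (auto intro: continuous_intros)
next
  case (Suc n)
  show ?case
  proof (rule higher_differentiable_on_SucI[OF assms(1)])
    fix x assume "x \<in> S"
    then show "((\<lambda>x. (f x, g x)) has_derivative
       (\<lambda>v. (frechet_derivative f (at x) v, frechet_derivative g (at x) v))) (at x)"
      by (intro has_derivative_Pair higher_differentiable_on_has_derivative[OF Suc.prems(1)]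
          higher_differentiable_on_has_derivative[OF Suc.prems(2)])
  next
    fix v
    show "higher_differentiable_on S
            (\<lambda>x. (frechet_derivative f (at x) v, frechet_derivative g (at x) v)) n"
      using Suc.prems by (intro Suc.IH) auto
  qed
qed

text \<open>In the chain rule the direction \<open>?Dg x v\<close> in which \<open>f\<close> is
  differentiated moves with \<open>x\<close>, whereas class C^n only controls derivatives of
  \<open>f\<close> in fixed directions. Expanding that direction in the finite basis of
  \<open>'b\<close> leaves sums of products of functions already under control.\<close>

lemma higher_differentiable_on_compose:
  fixes g :: "'a::real_normed_vector \<Rightarrow> 'b::euclidean_space"
  assumes "open S" "open T" "g ` S \<subseteq> T"
    and "higher_differentiable_on T f n" "higher_differentiable_on S g n"
  shows "higher_differentiable_on S (\<lambda>x. f (g x)) n"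
  using assms(4,5)
proof (induction n arbitrary: f)
  case 0
  then show ?case using continuous_on_compose2[of T f S g] assms(3) by auto
next
  case (Suc n)
  let ?Df = "\<lambda>y. frechet_derivative f (at y)" and ?Dg = "\<lambda>x. frechet_derivative g (at x)"
  show ?case
  proof (rule higher_differentiable_on_SucI[OF assms(1)])
    fix x assume x: "x \<in> S"
    then have f: "(f has_derivative ?Df (g x)) (at (g x))"
      using assms(3) by (intro higher_differentiable_on_has_derivative[OF Suc.prems(1)]) auto
    have g: "(g has_derivative ?Dg x) (at x)"
      by (intro higher_differentiable_on_has_derivative[OF Suc.prems(2)] x)
    interpret f: bounded_linear "?Df (g x)" using f by (rule has_derivative_bounded_linear)
    have "?Df (g x) w = (\<Sum>b\<in>Basis. (w \<bullet> b) *\<^sub>R ?Df (g x) b)" for w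
      by (subst euclidean_representation[of w, symmetric]) (simp only: f.sum f.scaleR)
    then have "(\<lambda>v. ?Df (g x) (?Dg x v)) = (\<lambda>v. \<Sum>b\<in>Basis. (?Dg x v \<bullet> b) *\<^sub>R ?Df (g x) b)"
      by blast
    with has_derivative_compose[OF g f]
    show "((\<lambda>x. f (g x)) has_derivative (\<lambda>v. \<Sum>b\<in>Basis. (?Dg x v \<bullet> b) *\<^sub>R ?Df (g x) b)) (at x)"
      by simp
  next
    fix v
    have "higher_differentiable_on S (\<lambda>x. (?Dg x v \<bullet> b) *\<^sub>R ?Df (g x) b) n" for b
    proof (rule bounded_bilinear.higher_differentiable_on_bilinear[OF bounded_bilinear_scaleR assms(1)])
      show "higher_differentiable_on S (\<lambda>x. ?Dg x v \<bullet> b) n"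
        using Suc.prems(2)
        by (intro bounded_linear.higher_differentiable_on_linear[OF bounded_linear_inner_left assms(1)]) auto
      show "higher_differentiable_on S (\<lambda>x. ?Df (g x) b) n"
        using Suc.prems(1) higher_differentiable_on_SucD[OF Suc.prems(2)]
        by (intro Suc.IH) auto
    qed
    then show "higher_differentiable_on S (\<lambda>x. \<Sum>b\<in>Basis. (?Dg x v \<bullet> b) *\<^sub>R ?Df (g x) b) n"
      by (intro higher_differentiable_on_sum[OF assms(1)])
  qed
qed

lemma higher_differentiable_on_real_SucI:
  fixes f :: "real \<Rightarrow> real"
  assumes "open S" and "\<And>x. x \<in> S \<Longrightarrow> (f has_real_derivative f' x) (at x)"
    and "higher_differentiable_on S f' n"
  shows "higher_differentiable_on S f (Suc n)"
proof (rule higher_differentiable_on_SucI[OF assms(1)])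
  show "(f has_derivative (\<lambda>v. f' x * v)) (at x)" if "x \<in> S" for x
    using assms(2)[OF that] by (simp add: has_field_derivative_def)
  show "higher_differentiable_on S (\<lambda>x. f' x * v) n" for v
    by (rule bounded_linear.higher_differentiable_on_linear[OF bounded_linear_mult_left assms(1,3)])
qed

section \<open>Closure properties of smooth functions\<close>

lemma smooth_on_imp_has_derivative:
  "smooth_on S f \<Longrightarrow> x \<in> S \<Longrightarrow> (f has_derivative frechet_derivative f (at x)) (at x)"
  unfolding smooth_on_def using higher_differentiable_on_has_derivative by blast

lemma smooth_on_imp_continuous_on: "smooth_on S f \<Longrightarrow> continuous_on S f"
  unfolding smooth_on_def using higher_differentiable_on_imp_continuous_on by blast

lemma smooth_on_frechet_derivative:
  "smooth_on S f \<Longrightarrow> smooth_on S (\<lambda>x. frechet_derivative f (at x) v)"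
  unfolding smooth_on_def using higher_differentiable_on.simps(2) by blast

lemma smooth_on_cong:
  assumes "open S" and "\<And>x. x \<in> S \<Longrightarrow> f x = g x"
  shows "smooth_on S f \<longleftrightarrow> smooth_on S g"
  unfolding smooth_on_def using higher_differentiable_on_cong[of S f g, OF assms] by blast

lemma smooth_on_const: "smooth_on S (\<lambda>x. c)"
  by (simp add: smooth_on_def higher_differentiable_on_const)

lemma smooth_on_ident: "open S \<Longrightarrow> smooth_on S (\<lambda>x. x)"
  by (simp add: smooth_on_def higher_differentiable_on_ident)

lemma smooth_on_Pair:
  "open S \<Longrightarrow> smooth_on S f \<Longrightarrow> smooth_on S g \<Longrightarrow> smooth_on S (\<lambda>x. (f x, g x))"
  by (simp add: smooth_on_def higher_differentiable_on_Pair)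

lemma smooth_on_compose:
  fixes g :: "'a::real_normed_vector \<Rightarrow> 'b::euclidean_space"
  assumes "open S" "open T" "g ` S \<subseteq> T" "smooth_on T f" "smooth_on S g"
  shows "smooth_on S (\<lambda>x. f (g x))"
  using assms higher_differentiable_on_compose[of S T g f] by (simp add: smooth_on_def)

lemma (in bounded_bilinear) smooth_on_bilinear:
  "open S \<Longrightarrow> smooth_on S f \<Longrightarrow> smooth_on S g \<Longrightarrow> smooth_on S (\<lambda>x. prod (f x) (g x))"
  by (simp add: smooth_on_def higher_differentiable_on_bilinear)

lemma (in bounded_linear) smooth_on_linear:
  "open S \<Longrightarrow> smooth_on S g \<Longrightarrow> smooth_on S (\<lambda>x. f (g x))"
  by (simp add: smooth_on_def higher_differentiable_on_linear)

text \<open>The derivative is a polynomial in \<open>inverse\<close> itself, so class C^n of the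
  function gives class C^n of its derivative, which is class C^(n+1).\<close>

lemma smooth_on_inverse: "smooth_on {0<..} (inverse :: real \<Rightarrow> real)"
proof -
  have "higher_differentiable_on {0<..} (inverse :: real \<Rightarrow> real) n" for n
  proof (induction n)
    case 0
    then show ?case by (auto intro!: continuous_intros)
  next
    case (Suc n)
    have "higher_differentiable_on {0<..} (\<lambda>x::real. - (inverse x * inverse x)) n"
      by (intro bounded_linear.higher_differentiable_on_linear[OF bounded_linear_minus[OF bounded_linear_ident]]
          bounded_bilinear.higher_differentiable_on_bilinear[OF bounded_bilinear_mult] Suc.IH) auto
    then show ?case
      by (rule higher_differentiable_on_real_SucI[rotated -1])
        (auto intro!: derivative_eq_intros)
  qed
  then show ?thesis by (simp add: smooth_on_def)
qed

text \<open>The same bootstrapping, with the derivative \<open>inverse (sqrt x) / 2\<close>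
  expressed through the function itself.\<close>

lemma smooth_on_sqrt: "smooth_on {0<..} sqrt"
proof -
  have "higher_differentiable_on {0<..} sqrt n" for n
  proof (induction n)
    case 0
    then show ?case by (auto intro!: continuous_intros)
  next
    case (Suc n)
    have "higher_differentiable_on {0<..} (\<lambda>x. inverse (sqrt x)) n"
      using smooth_on_inverse Suc.IH
      by - (rule higher_differentiable_on_compose[where T = "{0<..}"], auto simp: smooth_on_def)
    then have "higher_differentiable_on {0<..} (\<lambda>x. inverse (sqrt x) / 2) n"
      by (intro bounded_linear.higher_differentiable_on_linear[OF bounded_linear_divide]) auto
    then show ?case
      by (rule higher_differentiable_on_real_SucI[rotated -1]) (auto intro: DERIV_real_sqrt)
  qed
  then show ?thesis by (simp add: smooth_on_def)
qed

lemma smooth_on_real_antiderivative: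
  fixes f :: "real \<Rightarrow> real"
  assumes "open S" "smooth_on S f'" and "\<And>x. x \<in> S \<Longrightarrow> (f has_real_derivative f' x) (at x)"
  shows "smooth_on S f"
  using higher_differentiable_on_SucD[OF higher_differentiable_on_real_SucI[OF assms(1,3)]] assms(2)
  unfolding smooth_on_def by blast

text \<open>The third bootstrapping argument: the formula for the derivative of an inverse function
  is a differential equation for \<open>g\<close>, so each degree of smoothness of \<open>g\<close>
  yields one more.\<close>

lemma smooth_on_inverse_function:
  fixes g :: "real \<Rightarrow> real"
  assumes "open S" "open T" "g ` T \<subseteq> S" "smooth_on S f'" "\<And>x. x \<in> S \<Longrightarrow> f' x > 0"
    and g: "\<And>y. y \<in> T \<Longrightarrow> (g has_real_derivative inverse (f' (g y))) (at y)"
  shows "smooth_on T g"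
proof -
  have "higher_differentiable_on T g n" for n
  proof (induction n)
    case 0
    then show ?case
      using g by (auto intro!: continuous_at_imp_continuous_on DERIV_isCont)
  next
    case (Suc n)
    have "higher_differentiable_on T (\<lambda>y. f' (g y)) n"
      using assms Suc.IH
      by - (rule higher_differentiable_on_compose[where T = S], auto simp: smooth_on_def)
    then have "higher_differentiable_on T (\<lambda>y. inverse (f' (g y))) n"
      using assms smooth_on_inverse
      by - (rule higher_differentiable_on_compose[where T = "{0<..}" and f = inverse],
        auto simp: smooth_on_def image_subset_iff)
    then show ?case
      by (rule higher_differentiable_on_real_SucI[OF assms(2) g, rotated])
  qed
  then show ?thesis by (simp add: smooth_on_def)
qed

subsection \<open>Partial derivatives\<close>

lemma partial_eqI:
  assumes "(h has_derivative h') (at p)"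
  shows "partial_x h p = h' (1, 0)" and "partial_y h p = h' (0, 1)"
proof -
  have h: "(h has_derivative h') (at (fst p, snd p))" using assms by simp
  note scale = linear_scale[OF has_derivative_linear[OF assms]]
  have "h' (t, 0) = t *\<^sub>R h' (1, 0)" "h' (0, t) = t *\<^sub>R h' (0, 1)" for t
    using scale[of t "(1, 0)"] scale[of t "(0, 1)"] by simp_all
  note scale = this[THEN ext]
  have "((\<lambda>t. (t, snd p)) has_derivative (\<lambda>t. (t, 0))) (at (fst p))"
    by (auto intro!: derivative_eq_intros)
  note has_derivative_eq_rhs[OF has_derivative_compose[OF this h] scale(1)]
  then show "partial_x h p = h' (1, 0)"
    unfolding partial_x_def by (intro vector_derivative_at) (simp add: has_vector_derivative_def)
  have "((\<lambda>t. (fst p, t)) has_derivative (\<lambda>t. (0, t))) (at (snd p))"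
    by (auto intro!: derivative_eq_intros)
  note has_derivative_eq_rhs[OF has_derivative_compose[OF this h] scale(2)]
  then show "partial_y h p = h' (0, 1)"
    unfolding partial_y_def by (intro vector_derivative_at) (simp add: has_vector_derivative_def)
qed

lemma smooth_on_has_derivative_partials:
  assumes "smooth_on D h" "p \<in> D"
  shows "(h has_derivative (\<lambda>v. fst v *\<^sub>R partial_x h p + snd v *\<^sub>R partial_y h p)) (at p)"
proof -
  let ?h' = "frechet_derivative h (at p)"
  have h: "(h has_derivative ?h') (at p)" using assms by (rule smooth_on_imp_has_derivative)
  note lin = has_derivative_linear[OF h]
  have key: "?h' (a, b) = a *\<^sub>R ?h' (1, 0) + b *\<^sub>R ?h' (0, 1)" for a b
  proof -
    have "?h' (a *\<^sub>R (1, 0) + b *\<^sub>R (0, 1)) = a *\<^sub>R ?h' (1, 0) + b *\<^sub>R ?h' (0, 1)"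
      by (simp only: linear_add[OF lin] linear_scale[OF lin])
    then show ?thesis by simp
  qed
  have "?h' v = fst v *\<^sub>R ?h' (1, 0) + snd v *\<^sub>R ?h' (0, 1)" for v
    using key[of "fst v" "snd v"] unfolding prod.collapse .
  then show ?thesis
    unfolding partial_eqI[OF h] by (intro has_derivative_eq_rhs[OF h] ext)
qed

lemma smooth_on_has_partial_derivative:
  assumes "smooth_on D h" "(x, y) \<in> D"
  shows "((\<lambda>t. h (t, y)) has_vector_derivative partial_x h (x, y)) (at x)"
    and "((\<lambda>t. h (x, t)) has_vector_derivative partial_y h (x, y)) (at y)"
proof -
  note h = smooth_on_has_derivative_partials[OF assms]
  have "((\<lambda>t. (t, y)) has_derivative (\<lambda>t. (t, 0))) (at x)"
    by (auto intro!: derivative_eq_intros)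
  from has_derivative_compose[OF this h]
  show "((\<lambda>t. h (t, y)) has_vector_derivative partial_x h (x, y)) (at x)"
    by (simp add: has_vector_derivative_def)
  have "((\<lambda>t. (x, t)) has_derivative (\<lambda>t. (0, t))) (at y)"
    by (auto intro!: derivative_eq_intros)
  from has_derivative_compose[OF this h]
  show "((\<lambda>t. h (x, t)) has_vector_derivative partial_y h (x, y)) (at y)"
    by (simp add: has_vector_derivative_def)
qed

lemma smooth_on_partial:
  assumes "open D" "smooth_on D h"
  shows "smooth_on D (partial_x h)" and "smooth_on D (partial_y h)"
proof -
  note h = smooth_on_imp_has_derivative[OF assms(2)]
  show "smooth_on D (partial_x h)"
    by (rule iffD2[OF smooth_on_cong[OF assms(1) partial_eqI(1)[OF h]]
        smooth_on_frechet_derivative[OF assms(2)]])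
  show "smooth_on D (partial_y h)"
    by (rule iffD2[OF smooth_on_cong[OF assms(1) partial_eqI(2)[OF h]]
        smooth_on_frechet_derivative[OF assms(2)]])
qed

text \<open>Allows an identity valid on all of \<open>D\<close> to be differentiated.\<close>

lemma partial_cong:
  assumes "open D" "smooth_on D f" "p \<in> D" and "\<And>q. q \<in> D \<Longrightarrow> f q = g q"
  shows "partial_x f p = partial_x g p" and "partial_y f p = partial_y g p"
proof -
  have "(g has_derivative (\<lambda>v. fst v *\<^sub>R partial_x f p + snd v *\<^sub>R partial_y f p)) (at p)"
    using has_derivative_transform_within_open
      [OF smooth_on_has_derivative_partials[OF assms(2,3)] assms(1,3)] assms(4) by blast
  from partial_eqI[OF this] show "partial_x f p = partial_x g p" and "partial_y f p = partial_y g p"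
    by simp_all
qed

section \<open>Symmetry of mixed partial derivatives\<close>

lemma second_difference_mean_value:
  fixes f fx fxy :: "real \<Rightarrow> real \<Rightarrow> real"
  assumes "h > 0"
    and fx: "\<And>s t. s \<in> {x..x+h} \<Longrightarrow> t \<in> {y..y+h} \<Longrightarrow> ((\<lambda>s. f s t) has_real_derivative fx s t) (at s)"
    and fxy: "\<And>s t. s \<in> {x..x+h} \<Longrightarrow> t \<in> {y..y+h} \<Longrightarrow> (fx s has_real_derivative fxy s t) (at t)"
  shows "\<exists>\<xi>\<in>{x..x+h}. \<exists>\<eta>\<in>{y..y+h}.
           f (x + h) (y + h) - f (x + h) y - f x (y + h) + f x y = h * h * fxy \<xi> \<eta>"
proof -
  \<comment> \<open>The second difference is read as an increment in the first variable of the
    difference of \<open>f\<close> between the levels \<open>y + h\<close> and \<open>y\<close>. A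
    second use of the mean value theorem then handles the second variable.\<close>
  have "\<exists>\<xi>>x. \<xi> < x + h \<and> (f (x + h) (y + h) - f (x + h) y) - (f x (y + h) - f x y)
          = (x + h - x) * (fx \<xi> (y + h) - fx \<xi> y)"
    using assms(1) by (intro MVT2[where f = "\<lambda>s. f s (y + h) - f s y"])
      (auto intro!: derivative_intros fx)
  then obtain \<xi> where \<xi>: "x < \<xi>" "\<xi> < x + h"
    "(f (x + h) (y + h) - f (x + h) y) - (f x (y + h) - f x y) = h * (fx \<xi> (y + h) - fx \<xi> y)"
    by auto
  have "\<exists>\<eta>>y. \<eta> < y + h \<and> fx \<xi> (y + h) - fx \<xi> y = (y + h - y) * fxy \<xi> \<eta>"
    using assms(1) \<xi> by (intro MVT2[where f = "fx \<xi>"]) (auto intro!: fxy)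
  then obtain \<eta> where "y < \<eta>" "\<eta> < y + h" "fx \<xi> (y + h) - fx \<xi> y = h * fxy \<xi> \<eta>"
    by auto
  with \<xi> show ?thesis
    by (intro bexI[of _ \<xi>] bexI[of _ \<eta>]) auto
qed

lemma has_real_derivative_inner_left:
  assumes "(f has_vector_derivative f') (at t)"
  shows "((\<lambda>t. f t \<bullet> w) has_real_derivative f' \<bullet> w) (at t)"
  using bounded_linear.has_vector_derivative[OF bounded_linear_inner_left assms]
  by (simp add: has_real_derivative_iff_has_vector_derivative)

text \<open>Classical argument: the second difference over a small square equals its area times
  either mixed derivative, taken at some point of the square. Shrinking the square and using
  continuity identifies the two at \<open>p\<close>. Pairing with an arbitrary \<open>w\<close>
  reduces vector values to real ones, as the mean value theorem requires.\<close>

lemma partial_x_partial_y_commute: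
  fixes h :: "real \<times> real \<Rightarrow> 'b::real_inner"
  assumes "open D" "smooth_on D h" "p \<in> D"
  shows "partial_x (partial_y h) p = partial_y (partial_x h) p"
proof -
  let ?hxy = "partial_y (partial_x h)" and ?hyx = "partial_x (partial_y h)"
  obtain x y where p: "p = (x, y)" by (cases p)
  obtain e where e: "e > 0" "ball p e \<subseteq> D" using assms openE by blast
  \<comment> \<open>The square of side \<open>r\<close> with corner \<open>p\<close> lies within
    distance 2 \<open>r\<close> < \<open>e\<close> of \<open>p\<close>.\<close>
  define r where "r = e / 4"
  have "r > 0" using e by (simp add: r_def)
  have box: "(s, t) \<in> D" if "s \<in> {x..x + r}" "t \<in> {y..y + r}" for s t
  proof -
    have "dist p (s, t) \<le> \<bar>x - s\<bar> + \<bar>y - t\<bar>"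
      unfolding p dist_Pair_Pair dist_real_def
      by (rule order_trans[OF sqrt_sum_squares_le_sum_abs]) simp
    also have "\<dots> < e" using that e by (auto simp: r_def)
    finally show ?thesis using e by auto
  qed
  have eq: "?hyx p \<bullet> w = ?hxy p \<bullet> w" for w
  proof -
    have ex: "\<exists>P\<in>{x..x+k} \<times> {y..y+k}. \<exists>Q\<in>{x..x+k} \<times> {y..y+k}. ?hxy P \<bullet> w = ?hyx Q \<bullet> w"
      if k: "0 < k" "k \<le> r" for k
    proof -
      let ?\<Delta> = "h (x + k, y + k) \<bullet> w - h (x + k, y) \<bullet> w - h (x, y + k) \<bullet> w + h (x, y) \<bullet> w"
      have D: "(s, t) \<in> D" if "s \<in> {x..x + k}" "t \<in> {y..y + k}" for s t
        using that k by (intro box) auto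
      note inner_deriv = has_real_derivative_inner_left
      note part = smooth_on_partial[OF assms(1,2)]
      have "\<exists>\<xi>\<in>{x..x+k}. \<exists>\<eta>\<in>{y..y+k}. ?\<Delta> = k * k * (?hxy (\<xi>, \<eta>) \<bullet> w)"
        by (rule second_difference_mean_value[where f = "\<lambda>s t. h (s, t) \<bullet> w"
              and fx = "\<lambda>s t. partial_x h (s, t) \<bullet> w" and fxy = "\<lambda>s t. ?hxy (s, t) \<bullet> w", OF k(1)])
          (intro inner_deriv smooth_on_has_partial_derivative(1)[OF assms(2)]
          smooth_on_has_partial_derivative(2)[OF part(1)] D; assumption)+
      then obtain P where P: "P \<in> {x..x+k} \<times> {y..y+k}" "?\<Delta> = k * k * (?hxy P \<bullet> w)"
        by blast
      \<comment> \<open>The same lemma with the variables exchanged. The second difference merely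
        has its two middle terms swapped, so the two right-hand sides coincide.\<close>
      have "\<exists>\<eta>\<in>{y..y+k}. \<exists>\<xi>\<in>{x..x+k}.
          h (x + k, y + k) \<bullet> w - h (x, y + k) \<bullet> w - h (x + k, y) \<bullet> w + h (x, y) \<bullet> w
            = k * k * (?hyx (\<xi>, \<eta>) \<bullet> w)"
        by (rule second_difference_mean_value[where f = "\<lambda>t s. h (s, t) \<bullet> w"
              and fx = "\<lambda>t s. partial_y h (s, t) \<bullet> w" and fxy = "\<lambda>t s. ?hyx (s, t) \<bullet> w", OF k(1)])
          (intro inner_deriv smooth_on_has_partial_derivative(2)[OF assms(2)]
          smooth_on_has_partial_derivative(1)[OF part(2)] D; assumption)+
      then obtain Q where Q: "Q \<in> {x..x+k} \<times> {y..y+k}" 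
        "h (x + k, y + k) \<bullet> w - h (x, y + k) \<bullet> w - h (x + k, y) \<bullet> w + h (x, y) \<bullet> w
          = k * k * (?hyx Q \<bullet> w)"
        by blast
      have "k * k * (?hxy P \<bullet> w) = k * k * (?hyx Q \<bullet> w)" using P(2) Q(2) by linarith
      with k have "?hxy P \<bullet> w = ?hyx Q \<bullet> w" by simp
      with P(1) Q(1) show ?thesis by blast
    qed
    define k where "k n = r / real (Suc n)" for n
    have k: "0 < k n" "k n \<le> r" for n
      using \<open>r > 0\<close> by (auto simp: k_def divide_le_eq)
    have "k \<longlonglongrightarrow> 0"
      unfolding k_def by (rule LIMSEQ_Suc) (rule lim_const_over_n)
    from ex[OF k] obtain P Q where PQ: "P n \<in> {x..x + k n} \<times> {y..y + k n}"
      "Q n \<in> {x..x + k n} \<times> {y..y + k n}" "?hxy (P n) \<bullet> w = ?hyx (Q n) \<bullet> w" for n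
      by metis
    have lim: "R \<longlonglongrightarrow> p" if R: "\<And>n. R n \<in> {x..x + k n} \<times> {y..y + k n}" for R
    proof -
      have up: "(\<lambda>n. x + k n) \<longlonglongrightarrow> x" "(\<lambda>n. y + k n) \<longlonglongrightarrow> y"
        using tendsto_add[OF tendsto_const \<open>k \<longlonglongrightarrow> 0\<close>] by auto
      have "(\<lambda>n. fst (R n)) \<longlonglongrightarrow> x"
        using R by (intro tendsto_sandwich[OF _ _ tendsto_const up(1)]) (auto simp: mem_Times_iff)
      moreover have "(\<lambda>n. snd (R n)) \<longlonglongrightarrow> y"
        using R by (intro tendsto_sandwich[OF _ _ tendsto_const up(2)]) (auto simp: mem_Times_iff)
      ultimately show ?thesis unfolding p using tendsto_Pair by fastforce
    qed
    have cont: "isCont (\<lambda>q. H q \<bullet> w) p" if "smooth_on D H" for H :: "real \<times> real \<Rightarrow> 'b"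
      using smooth_on_imp_continuous_on[OF that] assms
      by (intro continuous_intros) (simp add: continuous_on_eq_continuous_at)
    have "(\<lambda>n. ?hxy (P n) \<bullet> w) \<longlonglongrightarrow> ?hxy p \<bullet> w"
      by (intro isCont_tendsto_compose[OF cont] lim PQ smooth_on_partial assms)
    moreover have "(\<lambda>n. ?hyx (Q n) \<bullet> w) \<longlonglongrightarrow> ?hyx p \<bullet> w"
      by (intro isCont_tendsto_compose[OF cont] lim PQ smooth_on_partial assms)
    ultimately show ?thesis using PQ(3) LIMSEQ_unique by simp
  qed
  show ?thesis using eq vector_eq_rdot by blast
qed

section \<open>Product maps and reparametrizations of intervals\<close>

lemma partial_compose_map_prod:
  assumes "smooth_on D h" "map_prod \<alpha> \<beta> q \<in> D"
    and "(\<alpha> has_real_derivative a) (at (fst q))" "(\<beta> has_real_derivative b) (at (snd q))"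
  shows "partial_x (h \<circ> map_prod \<alpha> \<beta>) q = a *\<^sub>R partial_x h (map_prod \<alpha> \<beta> q)"
    and "partial_y (h \<circ> map_prod \<alpha> \<beta>) q = b *\<^sub>R partial_y h (map_prod \<alpha> \<beta> q)"
proof -
  have "(\<alpha> has_derivative (\<lambda>t. a * t)) (at (fst q))" "(\<beta> has_derivative (\<lambda>t. b * t)) (at (snd q))"
    using assms(3,4) by (simp_all add: has_field_derivative_def)
  then have "(map_prod \<alpha> \<beta> has_derivative (\<lambda>v. (a * fst v, b * snd v))) (at q)"
    unfolding map_prod_def case_prod_beta
    by (auto intro!: has_derivative_Pair has_derivative_compose[OF has_derivative_fst[OF has_derivative_ident]]
       has_derivative_compose[OF has_derivative_snd[OF has_derivative_ident]])
  from has_derivative_compose[OF this smooth_on_has_derivative_partials[OF assms(1,2)]]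
  have "(h \<circ> map_prod \<alpha> \<beta> has_derivative (\<lambda>v. (a * fst v) *\<^sub>R partial_x h (map_prod \<alpha> \<beta> q) +
           (b * snd v) *\<^sub>R partial_y h (map_prod \<alpha> \<beta> q))) (at q)"
    by (simp add: o_def)
  from partial_eqI[OF this]
  show "partial_x (h \<circ> map_prod \<alpha> \<beta>) q = a *\<^sub>R partial_x h (map_prod \<alpha> \<beta> q)"
    and "partial_y (h \<circ> map_prod \<alpha> \<beta>) q = b *\<^sub>R partial_y h (map_prod \<alpha> \<beta> q)"
    by simp_all
qed

lemma smooth_on_map_prod:
  fixes \<alpha> \<beta> :: "real \<Rightarrow> real"
  assumes "open J" "open K" "smooth_on J \<alpha>" "smooth_on K \<beta>"
  shows "smooth_on (J \<times> K) (map_prod \<alpha> \<beta>)"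
proof -
  have JK: "open (J \<times> K)" using assms by (intro open_Times)
  have "smooth_on (J \<times> K) (\<lambda>q. (\<alpha> (fst q), \<beta> (snd q)))"
    by (intro smooth_on_Pair[OF JK] smooth_on_compose[OF JK assms(1) _ assms(3)]
        smooth_on_compose[OF JK assms(2) _ assms(4)]
        bounded_linear.smooth_on_linear[OF bounded_linear_fst JK]
        bounded_linear.smooth_on_linear[OF bounded_linear_snd JK] smooth_on_ident[OF JK]) auto
  moreover have "(\<lambda>q. (\<alpha> (fst q), \<beta> (snd q))) = map_prod \<alpha> \<beta>" by auto
  ultimately show ?thesis by simp
qed

text \<open>Supplies the new parameter dA = \<open>a\<close> ds: \<open>A\<close> is an
  antiderivative of \<open>a\<close>, strictly increasing because \<open>a > 0\<close>, and \<alpha>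
  is its inverse on the open image \<open>J\<close>.\<close>

lemma interval_reparametrization:
  fixes a :: "real \<Rightarrow> real"
  assumes "open S" "{c..d} \<subseteq> S" "smooth_on S a" "\<And>s. s \<in> S \<Longrightarrow> a s > 0"
  obtains A \<alpha> J where "open J" "homeomorphism {c<..<d} J A \<alpha>"
    "smooth_on {c<..<d} A" "smooth_on J \<alpha>"
    "\<And>s. s \<in> J \<Longrightarrow> (\<alpha> has_real_derivative inverse (a (\<alpha> s))) (at s)"
proof -
  let ?I = "{c<..<d}"
  have sub: "?I \<subseteq> S" using assms(2) by auto
  have "continuous_on {c..d} a"
    using smooth_on_imp_continuous_on[OF assms(3)] assms(2) continuous_on_subset by blast
  then obtain A where "\<And>s. s \<in> {c..d} \<Longrightarrow> (A has_vector_derivative a s) (at s within {c..d})"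
    using antiderivative_continuous by blast
  \<comment> \<open>At interior points the derivative relative to the closed interval is an ordinary
    one, which explains the passage to the open interval.\<close>
  then have A: "(A has_real_derivative a s) (at s)" if "s \<in> ?I" for s
    unfolding has_real_derivative_iff_has_vector_derivative
    using that at_within_Icc_at[of c s d] by (metis atLeastAtMost_iff greaterThanLessThan_iff less_imp_le)
  have cont: "continuous_on ?I A"
    using A DERIV_isCont by (blast intro: continuous_at_imp_continuous_on)
  have "A s < A t" if "s \<in> ?I" "t \<in> ?I" "s < t" for s t
  proof (rule DERIV_pos_imp_increasing[OF that(3)])
    fix u assume "s \<le> u" "u \<le> t"
    then have "u \<in> ?I" using that by auto
    then show "\<exists>y. DERIV A u :> y \<and> 0 < y" using A assms(4) sub by blast
  qed
  then have inj: "inj_on A ?I"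
    by (intro linorder_inj_onI) force+
  obtain \<alpha> where hom: "homeomorphism ?I (A ` ?I) A \<alpha>"
    by (rule invariance_of_domain_homeomorphism[OF _ cont _ inj]) auto
  have J: "open (A ` ?I)"
    by (rule invariance_of_domain[OF cont _ inj]) simp
  have smooth_a: "smooth_on ?I a"
    by (rule smooth_on_compose[OF _ assms(1) _ assms(3) smooth_on_ident]) (use sub in auto)
  have pos: "a s > 0" if "s \<in> ?I" for s using assms(4) sub that by blast
  have \<alpha>_in: "\<alpha> s \<in> ?I" if "s \<in> A ` ?I" for s
    using homeomorphism_image2[OF hom] that by blast
  have \<alpha>: "(\<alpha> has_real_derivative inverse (a (\<alpha> s))) (at s)" if s: "s \<in> A ` ?I" for s
    unfolding has_field_derivative_def
  proof (rule has_derivative_inverse_strong_x[of ?I \<alpha> s A])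
    show "(A has_derivative (\<lambda>t. a (\<alpha> s) * t)) (at (\<alpha> s))"
      using A[OF \<alpha>_in[OF s]] by (simp add: has_field_derivative_def)
    show "(\<lambda>t. a (\<alpha> s) * t) \<circ> (\<lambda>t. inverse (a (\<alpha> s)) * t) = id"
      using pos[OF \<alpha>_in[OF s]] by (auto simp: fun_eq_iff)
  qed (use cont \<alpha>_in[OF s] homeomorphism_apply1[OF hom] homeomorphism_apply2[OF hom s] in auto)
  show thesis
  proof (rule that[OF J hom _ _ \<alpha>])
    show "smooth_on ?I A" by (rule smooth_on_real_antiderivative[OF _ smooth_a A]) simp_all
    show "smooth_on (A ` ?I) \<alpha>"
      by (rule smooth_on_inverse_function[OF _ J _ smooth_a pos \<alpha>]) (use \<alpha>_in in auto)
  qed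
qed

subsection \<open>Surfaces and their reparametrizations\<close>

lemma bounded_bilinear_mink: "bounded_bilinear mink"
proof -
  have "bilinear mink"
    unfolding bilinear_def mink_def by (auto intro!: linearI simp: algebra_simps)
  then show ?thesis by (simp add: bilinear_conv_bounded_bilinear)
qed

interpretation mink: bounded_bilinear mink
  by (rule bounded_bilinear_mink)

lemma mink_commute: "mink a b = mink b a"
  by (simp add: mink_def algebra_simps)

lemma partial_mink:
  assumes "smooth_on D f" "smooth_on D g" "p \<in> D"
  shows "partial_x (\<lambda>q. mink (f q) (g q)) p = mink (partial_x f p) (g p) + mink (f p) (partial_x g p)"
    and "partial_y (\<lambda>q. mink (f q) (g q)) p = mink (partial_y f p) (g p) + mink (f p) (partial_y g p)"
  using partial_eqI[OF mink.FDERIV[OF smooth_on_has_derivative_partials[OF assms(1,3)]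
        smooth_on_has_derivative_partials[OF assms(2,3)]]]
  by simp_all

lemma partial_const: "partial_x (\<lambda>q. c) p = 0" "partial_y (\<lambda>q. c) p = 0"
  by (simp_all add: partial_x_def partial_y_def)

text \<open>The product rule applied to a constant moves a derivative to the other factor at the
  cost of a sign. It is applied to the relations l^2 = 1, <l, z_x> = <l, z_y> = 0, F = 0 and f =
  0.\<close>

lemma partial_mink_constant:
  assumes "open D" "smooth_on D f" "smooth_on D g" "p \<in> D" "\<And>q. q \<in> D \<Longrightarrow> mink (f q) (g q) = c"
  shows "mink (partial_x f p) (g p) = - mink (f p) (partial_x g p)"
    and "mink (partial_y f p) (g p) = - mink (f p) (partial_y g p)"
proof -
  have "partial_x (\<lambda>q. mink (f q) (g q)) p = 0" "partial_y (\<lambda>q. mink (f q) (g q)) p = 0"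
    using partial_cong[OF assms(1) smooth_on_const assms(4), of c "\<lambda>q. mink (f q) (g q)"] assms(5)
    by (simp_all add: partial_const)
  then show "mink (partial_x f p) (g p) = - mink (f p) (partial_x g p)"
    and "mink (partial_y f p) (g p) = - mink (f p) (partial_y g p)"
    using partial_mink[OF assms(2-4)] by simp_all
qed

text \<open>Nondegeneracy of the scalar product: pairing \<open>v\<close> with \<open>a\<close>,
  \<open>b\<close>, \<open>c\<close> is the matrix with these rows applied to \<open>v\<close> with
  its third coordinate negated, and that matrix is invertible.\<close>

lemma mink_eq_0_imp_eq_0:
  assumes "det (vector [a, b, c] :: real^3^3) \<noteq> 0"
    and "mink v a = 0" "mink v b = 0" "mink v c = 0"
  shows "v = 0"
proof -
  let ?M = "vector [a, b, c] :: real^3^3" and ?u = "vector [v$1, v$2, - v$3] :: real^3"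
  have "?M *v ?u = 0"
    using assms(2-4)
    by (simp add: vec_eq_iff forall_3 matrix_vector_mult_def sum_3 vector_3 mink_def algebra_simps)
  then have "?u = 0"
    using assms(1) invertible_det_nz[of ?M] matrix_left_invertible_ker[of ?M]
    unfolding invertible_def by blast
  then show ?thesis by (simp add: vec_eq_iff forall_3 vector_3)
qed

lemma det_vector_scaleR:
  "det (vector [a *\<^sub>R u, b *\<^sub>R v, w] :: real^3^3) = a * b * det (vector [u, v, w] :: real^3^3)"
  by (simp add: det_3 vector_3 algebra_simps)

text \<open>Isolates the smoothness and orthogonality conditions behind the formulas for the second
  fundamental form. A reparametrized surface can thus use these formulas before it is known to be a
  \<open>principal_surface\<close>.\<close>

locale surface_with_normal =
  fixes D :: "(real \<times> real) set" and z l :: "real \<times> real \<Rightarrow> real^3"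
  assumes open_D: "open D"
    and smooth_z: "smooth_on D z" and smooth_l: "smooth_on D l"
    and normal_x: "p \<in> D \<Longrightarrow> mink (l p) (partial_x z p) = 0"
    and normal_y: "p \<in> D \<Longrightarrow> mink (l p) (partial_y z p) = 0"
begin

lemmas smooth_zx = smooth_on_partial(1)[OF open_D smooth_z]
lemmas smooth_zy = smooth_on_partial(2)[OF open_D smooth_z]

text \<open>Expressing the second fundamental form by first derivatives of the normal means that
  changing parameters needs no chain rule for second derivatives.\<close>

lemma second_coeff_eq:
  assumes "p \<in> D"
  shows "coeff_e z l p = - mink (partial_x l p) (partial_x z p)"
    and "coeff_f z l p = - mink (partial_y l p) (partial_x z p)"
    and "coeff_f z l p = - mink (partial_x l p) (partial_y z p)"
    and "coeff_g z l p = - mink (partial_y l p) (partial_y z p)"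
proof -
  note x = partial_mink_constant[OF open_D smooth_l smooth_zx assms normal_x]
  note y = partial_mink_constant[OF open_D smooth_l smooth_zy assms normal_y]
  note sym = partial_x_partial_y_commute[OF open_D smooth_z assms]
  show "coeff_e z l p = - mink (partial_x l p) (partial_x z p)"
    using x(1) by (simp add: coeff_e_def mink_commute)
  show "coeff_f z l p = - mink (partial_y l p) (partial_x z p)"
    using x(2) by (simp add: coeff_f_def mink_commute)
  show "coeff_f z l p = - mink (partial_x l p) (partial_y z p)"
    using y(1) sym by (simp add: coeff_f_def mink_commute)
  show "coeff_g z l p = - mink (partial_y l p) (partial_y z p)"
    using y(2) by (simp add: coeff_g_def mink_commute)
qed

lemma smooth_second_coeff: "smooth_on D (coeff_e z l)" "smooth_on D (coeff_g z l)"
  unfolding coeff_e_def [abs_def] coeff_g_def [abs_def]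
  by (intro mink.smooth_on_bilinear smooth_on_partial open_D smooth_z smooth_l)+

end

section \<open>Weingarten and Codazzi equations in principal parameters\<close>

lemma surface_with_normal_if_principal_surface:
  "principal_surface w D z l \<Longrightarrow> surface_with_normal D z l"
  by (simp add: principal_surface_def spacelike_surface_def surface_with_normal_def)

lemma principal_surfaceD:
  assumes "principal_surface w D z l" "p \<in> D"
  shows "coeff_E z p > 0" "coeff_G z p < 0" "coeff_F z p = 0" "coeff_f z l p = 0"
    "mink (l p) (l p) = 1" "w * det (vector [partial_x z p, partial_y z p, l p] :: real^3^3) > 0"
  using assms
  by (auto simp: principal_surface_def spacelike_surface_def principal_net_def normal_convention_def)

text \<open>The difference of the two sides is orthogonal to the whole frame. Against
  \<open>l\<close> this follows from l^2 = 1, against the tangent vector of the other direction from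
  F = f = 0, and against the remaining one from the definition of the principal curvature.\<close>

lemma weingarten:
  assumes "principal_surface w D z l" "p \<in> D"
  shows "partial_x l p = - nu1 z l p *\<^sub>R partial_x z p"
    and "partial_y l p = - nu2 z l p *\<^sub>R partial_y z p"
proof -
  interpret surface_with_normal D z l
    using assms(1) by (rule surface_with_normal_if_principal_surface)
  note P = principal_surfaceD[OF assms]
  have det: "det (vector [partial_x z p, partial_y z p, l p] :: real^3^3) \<noteq> 0"
    using P(6) by auto
  \<comment> \<open>By symmetry of \<open>mink\<close>, differentiating l^2 = 1 makes each number
    equal to its own negative.\<close>
  have unit: "mink (partial_x l p) (l p) = 0" "mink (partial_y l p) (l p) = 0"
    using partial_mink_constant[OF open_D smooth_l smooth_l assms(2) principal_surfaceD(5)[OF assms(1)]]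
    by (simp_all add: mink_commute)
  have *: "mink (partial_x z p) (partial_y z p) = 0" "mink (partial_y z p) (partial_x z p) = 0"
    using P(3) by (simp_all add: coeff_F_def mink_commute)
  have n: "mink (partial_x z p) (l p) = 0" "mink (partial_y z p) (l p) = 0"
    using normal_x normal_y assms(2) by (simp_all add: mink_commute)
  have E: "mink (partial_x z p) (partial_x z p) = coeff_E z p"
    and G: "mink (partial_y z p) (partial_y z p) = coeff_G z p"
    by (simp_all add: coeff_E_def coeff_G_def)
  have "partial_x l p + nu1 z l p *\<^sub>R partial_x z p = 0"
    by (rule mink_eq_0_imp_eq_0[OF det])
      (use P second_coeff_eq[OF assms(2)] in
        \<open>simp_all add: mink.add_left mink.diff_left mink.scaleR_left unit * n E nu1_def\<close>)
  then show "partial_x l p = - nu1 z l p *\<^sub>R partial_x z p"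
    by (simp add: eq_neg_iff_add_eq_0)
  have "partial_y l p + nu2 z l p *\<^sub>R partial_y z p = 0"
    by (rule mink_eq_0_imp_eq_0[OF det])
      (use P second_coeff_eq[OF assms(2)] in
        \<open>simp_all add: mink.add_left mink.diff_left mink.scaleR_left unit * n G nu2_def\<close>)
  then show "partial_y l p = - nu2 z l p *\<^sub>R partial_y z p"
    by (simp add: eq_neg_iff_add_eq_0)
qed

text \<open>Differentiating e = <z_xx, l> in y gives <z_xxy, l> + <z_xx, l_y>. The first term is
  -<z_xy, l_x> because f = 0, and the second reduces to <z_x, z_xy> because F = 0. The Weingarten
  formulas make both multiples of <z_x, z_xy>, with factors \<open>nu1\<close> and
  \<open>nu2\<close>. The argument for g is the same with the variables exchanged.\<close>

lemma maximal_codazzi: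
  assumes "principal_surface w D z l" "maximal D z l" "p \<in> D"
  shows "partial_y (coeff_e z l) p = 0" and "partial_x (coeff_g z l) p = 0"
proof -
  interpret surface_with_normal D z l
    using assms(1) by (rule surface_with_normal_if_principal_surface)
  note sym_z = partial_x_partial_y_commute[OF open_D smooth_z]
  note smooth = smooth_zx smooth_zy smooth_on_partial[OF open_D smooth_zx]
    smooth_on_partial[OF open_D smooth_zy]
  have F: "mink (partial_x z q) (partial_y z q) = 0" if "q \<in> D" for q
    using principal_surfaceD(3)[OF assms(1) that] by (simp add: coeff_F_def)
  note F_deriv = partial_mink_constant[OF open_D smooth(1,2) assms(3) F]
  have f: "mink (partial_y (partial_x z) q) (l q) = 0" if "q \<in> D" for q
    using principal_surfaceD(4)[OF assms(1) that] by (simp add: coeff_f_def)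
  note f_deriv = partial_mink_constant[OF open_D smooth(4) smooth_l assms(3) f]
  \<comment> \<open>Maximality enters here, replacing \<open>nu2\<close> by \<open>- nu1\<close> in
    the second Weingarten formula.\<close>
  have l: "partial_x l p = - nu1 z l p *\<^sub>R partial_x z p"
    "partial_y l p = nu1 z l p *\<^sub>R partial_y z p"
    using weingarten[OF assms(1,3)] assms(2,3) by (auto simp: maximal_def add_eq_0_iff)
  have "partial_y (coeff_e z l) p =
      mink (partial_y (partial_x (partial_x z)) p) (l p) + mink (partial_x (partial_x z) p) (partial_y l p)"
    unfolding coeff_e_def [abs_def] using partial_mink(2)[OF smooth(3) smooth_l assms(3)] .
  also have "partial_y (partial_x (partial_x z)) p = partial_x (partial_y (partial_x z)) p"
    using partial_x_partial_y_commute[OF open_D smooth(1) assms(3)] by simp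
  also have "mink \<dots> (l p) = nu1 z l p * mink (partial_x z p) (partial_x (partial_y z) p)"
    using f_deriv(1) by (simp add: l(1) mink.minus_right mink.scaleR_right mink_commute sym_z[OF assms(3)])
  also have "mink (partial_x (partial_x z) p) (partial_y l p)
      = - nu1 z l p * mink (partial_x z p) (partial_x (partial_y z) p)"
    using F_deriv(1) by (simp add: l(2) mink.scaleR_right)
  finally show "partial_y (coeff_e z l) p = 0" by simp
  have "partial_x (coeff_g z l) p =
      mink (partial_x (partial_y (partial_y z)) p) (l p) + mink (partial_y (partial_y z) p) (partial_x l p)"
    unfolding coeff_g_def [abs_def] using partial_mink(1)[OF smooth(6) smooth_l assms(3)] .
  also have "partial_x (partial_y (partial_y z)) p = partial_y (partial_x (partial_y z)) p"
    by (rule partial_x_partial_y_commute[OF open_D smooth(2) assms(3)])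
  \<comment> \<open>Symmetry of the second derivatives holds on all of \<open>D\<close>, so it can
    be differentiated once more; this brings the expression into the form covered by
    \<open>f_deriv\<close>.\<close>
  also have "\<dots> = partial_y (partial_y (partial_x z)) p"
    by (rule partial_cong(2)[OF open_D smooth(5) assms(3) sym_z])
  also have "mink \<dots> (l p) = - nu1 z l p * mink (partial_y z p) (partial_y (partial_x z) p)"
    using f_deriv(2) by (simp add: l(2) mink.scaleR_right mink_commute)
  also have "mink (partial_y (partial_y z) p) (partial_x l p)
      = nu1 z l p * mink (partial_y z p) (partial_y (partial_x z) p)"
    using F_deriv(2)
    by (simp add: l(1) mink.minus_right mink.scaleR_right mink_commute)
  finally show "partial_x (coeff_g z l) p = 0" by simp
qed

text \<open>A product map rescales z_x and z_y separately. E and e acquire the factor a^2, G and g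
  the factor b^2, F and f the factor ab. Hence the net stays principal and \<open>nu1\<close>,
  \<open>nu2\<close> are merely composed with the map, while \<open>a\<close>, \<open>b\<close> > 0
  preserve the orientation.\<close>

lemma principal_surface_reparametrization:
  assumes surf: "principal_surface w D z l"
    and J: "open J" "connected J" "J \<noteq> {}" and K: "open K" "connected K" "K \<noteq> {}"
    and smooth: "smooth_on J \<alpha>" "smooth_on K \<beta>"
    and \<alpha>: "\<And>s. s \<in> J \<Longrightarrow> (\<alpha> has_real_derivative a s) (at s)" "\<And>s. s \<in> J \<Longrightarrow> a s > 0"
    and \<beta>: "\<And>t. t \<in> K \<Longrightarrow> (\<beta> has_real_derivative b t) (at t)" "\<And>t. t \<in> K \<Longrightarrow> b t > 0"
    and sub: "map_prod \<alpha> \<beta> ` (J \<times> K) \<subseteq> D"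
  shows "principal_surface w (J \<times> K) (z \<circ> map_prod \<alpha> \<beta>) (l \<circ> map_prod \<alpha> \<beta>)"
proof -
  let ?\<psi> = "map_prod \<alpha> \<beta>" and ?V = "J \<times> K"
  interpret surface_with_normal D z l
    using surf by (rule surface_with_normal_if_principal_surface)
  have V: "open ?V" using J K by (intro open_Times)
  note \<psi> = smooth_on_map_prod[OF J(1) K(1) smooth]
  have smooth_comp: "smooth_on ?V (h \<circ> ?\<psi>)" if "smooth_on D h" for h :: "real \<times> real \<Rightarrow> real^3"
    unfolding o_def by (rule smooth_on_compose[OF V open_D sub that \<psi>])
  have D: "?\<psi> q \<in> D" if "q \<in> ?V" for q using sub that by blast
  have partials: "partial_x (h \<circ> ?\<psi>) q = a (fst q) *\<^sub>R partial_x h (?\<psi> q)"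
      "partial_y (h \<circ> ?\<psi>) q = b (snd q) *\<^sub>R partial_y h (?\<psi> q)"
    if "smooth_on D h" "q \<in> ?V" for h :: "real \<times> real \<Rightarrow> real^3" and q
    using partial_compose_map_prod[OF that(1) D[OF that(2)] \<alpha>(1) \<beta>(1)] that(2)
    by (simp_all add: mem_Times_iff)
  note [simp] = partials[OF smooth_z] partials[OF smooth_l]
  interpret V: surface_with_normal ?V "z \<circ> ?\<psi>" "l \<circ> ?\<psi>"
    using V smooth_comp smooth_z smooth_l normal_x normal_y D
    by unfold_locales (simp_all add: mink.scaleR_right)
  have pos: "a (fst q) > 0" "b (snd q) > 0" if "q \<in> ?V" for q
    using that \<alpha>(2) \<beta>(2) by (auto simp: mem_Times_iff)
  have coeffs: "coeff_E (z \<circ> ?\<psi>) q = (a (fst q))\<^sup>2 * coeff_E z (?\<psi> q)"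
    "coeff_F (z \<circ> ?\<psi>) q = a (fst q) * b (snd q) * coeff_F z (?\<psi> q)"
    "coeff_G (z \<circ> ?\<psi>) q = (b (snd q))\<^sup>2 * coeff_G z (?\<psi> q)"
    "coeff_e (z \<circ> ?\<psi>) (l \<circ> ?\<psi>) q = (a (fst q))\<^sup>2 * coeff_e z l (?\<psi> q)"
    "coeff_f (z \<circ> ?\<psi>) (l \<circ> ?\<psi>) q = a (fst q) * b (snd q) * coeff_f z l (?\<psi> q)"
    "coeff_g (z \<circ> ?\<psi>) (l \<circ> ?\<psi>) q = (b (snd q))\<^sup>2 * coeff_g z l (?\<psi> q)"
    if "q \<in> ?V" for q
    using that V.second_coeff_eq(1,2,4)[OF that] second_coeff_eq(1,2,4)[OF D[OF that]]
    by (simp_all add: coeff_E_def coeff_F_def coeff_G_def mink.scaleR_left mink.scaleR_right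
        power2_eq_square)
  note P = principal_surfaceD[OF surf D]
  have nu: "nu1 (z \<circ> ?\<psi>) (l \<circ> ?\<psi>) q = nu1 z l (?\<psi> q)" "nu2 (z \<circ> ?\<psi>) (l \<circ> ?\<psi>) q = nu2 z l (?\<psi> q)"
    if "q \<in> ?V" for q
    using pos[OF that] by (simp_all add: nu1_def nu2_def coeffs[OF that])
  have sign: "coeff_E (z \<circ> ?\<psi>) q > 0" "coeff_G (z \<circ> ?\<psi>) q < 0" "coeff_F (z \<circ> ?\<psi>) q = 0"
    if "q \<in> ?V" for q
    using P[OF that] pos[OF that] by (simp_all add: coeffs[OF that] mult_pos_neg)
  have "inj (frechet_derivative (z \<circ> ?\<psi>) (at q))" if q: "q \<in> ?V" for q
  proof -
    let ?zx = "partial_x (z \<circ> ?\<psi>) q" and ?zy = "partial_y (z \<circ> ?\<psi>) q"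
    note z' = smooth_on_has_derivative_partials[OF V.smooth_z q]
    \<comment> \<open>Pairing the relation with each tangent vector isolates one coefficient, since
      F = 0 while E and G do not vanish.\<close>
    have "v = 0" if "fst v *\<^sub>R ?zx + snd v *\<^sub>R ?zy = 0" for v
    proof -
      have "mink (fst v *\<^sub>R ?zx + snd v *\<^sub>R ?zy) ?zx = fst v * coeff_E (z \<circ> ?\<psi>) q + snd v * coeff_F (z \<circ> ?\<psi>) q"
        "mink (fst v *\<^sub>R ?zx + snd v *\<^sub>R ?zy) ?zy = fst v * coeff_F (z \<circ> ?\<psi>) q + snd v * coeff_G (z \<circ> ?\<psi>) q"
        by (simp_all add: mink.add_left mink.scaleR_left coeff_E_def coeff_F_def coeff_G_def
            mink_commute[of ?zy ?zx] del: partials o_apply)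
      with sign[OF q] show ?thesis
        unfolding that by (auto simp: mink.zero_left prod_eq_iff)
    qed
    then show ?thesis
      using frechet_derivative_at[OF z'] linear_injective_0[OF has_derivative_linear[OF z']] by metis
  qed
  moreover have "\<not> umbilical (z \<circ> ?\<psi>) (l \<circ> ?\<psi>) q" if q: "q \<in> ?V" for q
  proof
    assume "umbilical (z \<circ> ?\<psi>) (l \<circ> ?\<psi>) q"
    then have "umbilical z l (?\<psi> q)"
      using pos[OF q] unfolding umbilical_def coeffs[OF q] by auto
    then show False
      using surf D[OF q] by (auto simp: principal_surface_def spacelike_surface_def)
  qed
  moreover have "connected ?V" "?V \<noteq> {}" using J K by (auto intro: connected_Times)
  moreover have "w * det (vector [partial_x (z \<circ> ?\<psi>) q, partial_y (z \<circ> ?\<psi>) q, (l \<circ> ?\<psi>) q] :: real^3^3) > 0"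
    if q: "q \<in> ?V" for q
    using P(6)[OF q] pos[OF q] q
    by (simp add: det_vector_scaleR mult.left_commute[of w] del: mult.assoc)
  moreover have "nu1 z l (?\<psi> q) - nu2 z l (?\<psi> q) > 0" if q: "q \<in> ?V" for q
    using surf D[OF q] by (simp add: principal_surface_def normal_convention_def)
  ultimately show ?thesis
    unfolding principal_surface_def spacelike_surface_def principal_net_def normal_convention_def
    using V V.smooth_z V.smooth_l V.normal_x V.normal_y sign P nu coeffs
    by simp
qed

section \<open>Product neighbourhoods and construction of the new parameters\<close>

lemma continuous_on_map_prod:
  assumes "continuous_on S f" "continuous_on T g"
  shows "continuous_on (S \<times> T) (map_prod f g)"
  unfolding map_prod_def case_prod_beta
  by (intro continuous_on_Pair continuous_on_compose2[OF assms(1)] continuous_on_compose2[OF assms(2)]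
      continuous_intros) auto

lemma homeomorphism_map_prod:
  assumes "homeomorphism I J A \<alpha>" "homeomorphism I' J' B \<beta>"
  shows "homeomorphism (I \<times> I') (J \<times> J') (map_prod A B) (map_prod \<alpha> \<beta>)"
  using assms unfolding homeomorphism_def by (auto simp: map_prod_surj_on continuous_on_map_prod)

text \<open>\<open>D\<close> may have an arbitrary shape, so a vanishing partial derivative gives
  constancy only along segments inside \<open>D\<close>. This is why the parameters are built on a
  box.\<close>

lemma constant_on_segment_if_partial_x_eq_0:
  fixes c :: "real \<times> real \<Rightarrow> real"
  assumes "smooth_on D c" "convex T" "T \<times> {y} \<subseteq> D" "\<And>p. p \<in> D \<Longrightarrow> partial_x c p = 0"
    and "s \<in> T" "t \<in> T"
  shows "c (s, y) = c (t, y)"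
proof -
  have "((\<lambda>r. c (r, y)) has_real_derivative 0) (at r within T)" if "r \<in> T" for r
  proof -
    have "(r, y) \<in> D" using assms(3) that by auto
    from smooth_on_has_partial_derivative(1)[OF assms(1) this] assms(4)[OF this] show ?thesis
      by (simp add: has_real_derivative_iff_has_vector_derivative has_vector_derivative_at_within)
  qed
  from has_field_derivative_zero_constant[OF assms(2) this] assms(5,6)
  show ?thesis by fastforce
qed

lemma constant_on_segment_if_partial_y_eq_0:
  fixes c :: "real \<times> real \<Rightarrow> real"
  assumes "smooth_on D c" "convex T" "{x} \<times> T \<subseteq> D" "\<And>p. p \<in> D \<Longrightarrow> partial_y c p = 0"
    and "s \<in> T" "t \<in> T"
  shows "c (x, s) = c (x, t)"
proof -
  have "((\<lambda>r. c (x, r)) has_real_derivative 0) (at r within T)" if "r \<in> T" for r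
  proof -
    have "(x, r) \<in> D" using assms(3) that by auto
    from smooth_on_has_partial_derivative(2)[OF assms(1) this] assms(4)[OF this] show ?thesis
      by (simp add: has_real_derivative_iff_has_vector_derivative has_vector_derivative_at_within)
  qed
  from has_field_derivative_zero_constant[OF assms(2) this] assms(5,6)
  show ?thesis by fastforce
qed

theorem proposition4p2:
  fixes D :: "(real \<times> real) set" and z l :: "real \<times> real \<Rightarrow> real^3"
    and w :: real and \<nu> :: "real \<times> real \<Rightarrow> real"
  assumes "w \<noteq> 0"
    and "principal_surface w D z l"
    and "strongly_regular D z"
    and "maximal D z l"
    and "\<And>p. p \<in> D \<Longrightarrow> \<nu> p = nu1 z l p"
    and "\<And>p. p \<in> D \<Longrightarrow> \<nu> p > 0"
  shows "\<forall>p\<in>D. \<exists>U V \<phi> \<psi>.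
           p \<in> U \<and> U \<subseteq> D \<and> diffeomorphism U V \<phi> \<psi> \<and>
           principal_surface w V (z \<circ> \<psi>) (l \<circ> \<psi>) \<and>
           (\<forall>q\<in>V. mink (partial_x (z \<circ> \<psi>) q) (partial_x (z \<circ> \<psi>) q) = 1 / \<nu> (\<psi> q) \<and>
                  - mink (partial_y (z \<circ> \<psi>) q) (partial_y (z \<circ> \<psi>) q) = 1 / \<nu> (\<psi> q))"
proof
  fix p assume "p \<in> D"
  note surf = assms(2) and nu = assms(5) and nu_pos = assms(6)
  interpret surface_with_normal D z l
    using surf by (rule surface_with_normal_if_principal_surface)
  let ?e = "coeff_e z l" and ?g = "coeff_g z l"
  note P = principal_surfaceD[OF surf]
  have e: "?e q = \<nu> q * coeff_E z q" and g: "?g q = - \<nu> q * coeff_G z q" if "q \<in> D" for q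
  proof -
    have "\<nu> q = ?e q / coeff_E z q" "- \<nu> q = ?g q / coeff_G z q"
      using nu[OF that] assms(4) that by (auto simp: nu1_def nu2_def maximal_def add_eq_0_iff)
    with P(1,2)[OF that] show "?e q = \<nu> q * coeff_E z q" "?g q = - \<nu> q * coeff_G z q"
      by simp_all
  qed
  \<comment> \<open>Positivity places both coefficients in the domain where \<open>sqrt\<close> is
    smooth.\<close>
  have e_pos: "?e q > 0" and g_pos: "?g q > 0" if "q \<in> D" for q
    using P(1,2)[OF that] nu_pos[OF that] by (simp_all add: e[OF that] g[OF that] mult_pos_neg)
  obtain x y where p: "p = (x, y)" by (cases p)
  obtain X Y where XY: "open X" "open Y" "p \<in> X \<times> Y" "X \<times> Y \<subseteq> D"
    using open_prod_elim[OF open_D \<open>p \<in> D\<close>] .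
  have xX: "x \<in> X" and yY: "y \<in> Y" using XY(3) p by auto
  \<comment> \<open>A closed interval is kept inside the open factor because the antiderivative is
    formed on a compact interval.\<close>
  obtain r where r: "r > 0" "{x - r..x + r} \<subseteq> X"
    using XY(1) xX open_contains_cball[of X] by (auto simp: cball_eq_atLeastAtMost)
  obtain s where s: "s > 0" "{y - s..y + s} \<subseteq> Y"
    using XY(2) yY open_contains_cball[of Y] by (auto simp: cball_eq_atLeastAtMost)
  let ?I = "{x - r<..<x + r}" and ?I' = "{y - s<..<y + s}"
  \<comment> \<open>The densities are read off along the two coordinate lines through
    \<open>p\<close>; the Codazzi equations later carry their values to every point of the
    box.\<close>
  define a b where "a t = sqrt (?e (t, y))" and "b t = sqrt (?g (x, t))" for t
  have sub: "?I \<subseteq> X" "?I' \<subseteq> Y"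
    using r(2) s(2) by (simp_all add: subset_iff)
  have box: "?I \<times> ?I' \<subseteq> D"
    by (rule order_trans[OF Sigma_mono[OF sub] XY(4)])
  have xy: "x \<in> ?I" "y \<in> ?I'" using r(1) s(1) by simp_all
  have XD: "(t, y) \<in> D" if "t \<in> X" for t using that yY XY(4) by blast
  have YD: "(x, t) \<in> D" if "t \<in> Y" for t using that xX XY(4) by blast
  have "smooth_on X (\<lambda>t. ?e (t, y))"
    by (rule smooth_on_compose[OF XY(1) open_D _ smooth_second_coeff(1)
          smooth_on_Pair[OF XY(1) smooth_on_ident[OF XY(1)] smooth_on_const]]) (use XD in auto)
  then have "smooth_on X (\<lambda>t. sqrt (?e (t, y)))"
    by (rule smooth_on_compose[OF XY(1) _ _ smooth_on_sqrt, rotated 2]) (use e_pos XD in auto)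
  then have a: "smooth_on X a" "t \<in> X \<Longrightarrow> a t > 0" for t
    unfolding a_def [abs_def] using e_pos[OF XD] by simp_all
  have "smooth_on Y (\<lambda>t. ?g (x, t))"
    by (rule smooth_on_compose[OF XY(2) open_D _ smooth_second_coeff(2)
          smooth_on_Pair[OF XY(2) smooth_on_const smooth_on_ident[OF XY(2)]]]) (use YD in auto)
  then have "smooth_on Y (\<lambda>t. sqrt (?g (x, t)))"
    by (rule smooth_on_compose[OF XY(2) _ _ smooth_on_sqrt, rotated 2]) (use g_pos YD in auto)
  then have b: "smooth_on Y b" "t \<in> Y \<Longrightarrow> b t > 0" for t
    unfolding b_def [abs_def] using g_pos[OF YD] by simp_all
  obtain A \<alpha> J where A: "open J" "homeomorphism ?I J A \<alpha>" "smooth_on ?I A" "smooth_on J \<alpha>"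
    and \<alpha>: "\<And>t. t \<in> J \<Longrightarrow> (\<alpha> has_real_derivative inverse (a (\<alpha> t))) (at t)"
    by (rule interval_reparametrization[OF XY(1) r(2) a(1)]) (erule a(2), rule that)
  obtain B \<beta> K where B: "open K" "homeomorphism ?I' K B \<beta>" "smooth_on ?I' B" "smooth_on K \<beta>"
    and \<beta>: "\<And>t. t \<in> K \<Longrightarrow> (\<beta> has_real_derivative inverse (b (\<beta> t))) (at t)"
    by (rule interval_reparametrization[OF XY(2) s(2) b(1)]) (erule b(2), rule that)
  let ?\<psi> = "map_prod \<alpha> \<beta>"
  have \<alpha>_in: "\<alpha> t \<in> ?I" if "t \<in> J" for t using homeomorphism_image2[OF A(2)] that by blast
  have \<beta>_in: "\<beta> t \<in> ?I'" if "t \<in> K" for t using homeomorphism_image2[OF B(2)] that by blast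
  have \<psi>_in: "?\<psi> ` (J \<times> K) \<subseteq> D" using \<alpha>_in \<beta>_in box by blast
  have a_pos: "inverse (a (\<alpha> t)) > 0" if "t \<in> J" for t
    using a(2) \<alpha>_in[OF that] sub by (meson positive_imp_inverse_positive subsetD)
  have b_pos: "inverse (b (\<beta> t)) > 0" if "t \<in> K" for t
    using b(2) \<beta>_in[OF that] sub by (meson positive_imp_inverse_positive subsetD)
  have J: "connected J" "J \<noteq> {}" and K: "connected K" "K \<noteq> {}"
    using homeomorphic_connectedness[of ?I J] homeomorphic_connectedness[of ?I' K]
      homeomorphism_image1[OF A(2)] homeomorphism_image1[OF B(2)] A(2) B(2) xy
    unfolding homeomorphic_def by auto
  have "diffeomorphism (?I \<times> ?I') (J \<times> K) (map_prod A B) ?\<psi>"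
    unfolding diffeomorphism_def
    using A B by (intro conjI open_Times homeomorphism_map_prod smooth_on_map_prod) auto
  moreover have "principal_surface w (J \<times> K) (z \<circ> ?\<psi>) (l \<circ> ?\<psi>)"
    by (rule principal_surface_reparametrization
        [OF surf A(1) J B(1) K A(4) B(4) \<alpha> a_pos \<beta> b_pos \<psi>_in])
  moreover have "mink (partial_x (z \<circ> ?\<psi>) q) (partial_x (z \<circ> ?\<psi>) q) = 1 / \<nu> (?\<psi> q) \<and>
      - mink (partial_y (z \<circ> ?\<psi>) q) (partial_y (z \<circ> ?\<psi>) q) = 1 / \<nu> (?\<psi> q)"
    if q: "q \<in> J \<times> K" for q
  proof -
    obtain t u where tu: "q = (t, u)" "t \<in> J" "u \<in> K" using q by blast
    let ?P = "(\<alpha> t, \<beta> u)"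
    have PD: "?P \<in> D" using \<psi>_in tu by fastforce
    have \<alpha>t: "\<alpha> t \<in> ?I" and \<beta>u: "\<beta> u \<in> ?I'" using \<alpha>_in \<beta>_in tu by blast+
    have "?e (\<alpha> t, y) = ?e ?P"
      by (rule constant_on_segment_if_partial_y_eq_0[OF smooth_second_coeff(1), of ?I'])
        (use box \<alpha>t \<beta>u xy maximal_codazzi(1)[OF surf assms(4)] in auto)
    then have a2: "(a (\<alpha> t))\<^sup>2 = \<nu> ?P * coeff_E z ?P"
      using e_pos[OF PD] e[OF PD] by (simp add: a_def)
    have "?g (x, \<beta> u) = ?g ?P"
      by (rule constant_on_segment_if_partial_x_eq_0[OF smooth_second_coeff(2), of ?I])
        (use box \<alpha>t \<beta>u xy maximal_codazzi(2)[OF surf assms(4)] in auto)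
    then have b2: "(b (\<beta> u))\<^sup>2 = - \<nu> ?P * coeff_G z ?P"
      using g_pos[OF PD] g[OF PD] by (simp add: b_def)
    have "partial_x (z \<circ> ?\<psi>) q = inverse (a (\<alpha> t)) *\<^sub>R partial_x z ?P"
      "partial_y (z \<circ> ?\<psi>) q = inverse (b (\<beta> u)) *\<^sub>R partial_y z ?P"
      using partial_compose_map_prod[OF smooth_z, of \<alpha> \<beta> q] PD
        \<alpha>[OF tu(2)] \<beta>[OF tu(3)] tu(1) by simp_all
    then have "mink (partial_x (z \<circ> ?\<psi>) q) (partial_x (z \<circ> ?\<psi>) q) = coeff_E z ?P / (a (\<alpha> t))\<^sup>2"
      "mink (partial_y (z \<circ> ?\<psi>) q) (partial_y (z \<circ> ?\<psi>) q) = coeff_G z ?P / (b (\<beta> u))\<^sup>2"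
      by (simp_all add: mink.scaleR_left mink.scaleR_right coeff_E_def coeff_G_def
          power2_eq_square field_simps)
    \<comment> \<open>E and G cancel, leaving 1 / \<nu> and -1 / \<nu>.\<close>
    with P(1,2)[OF PD] show ?thesis unfolding a2 b2 by (simp add: tu(1))
  qed
  ultimately show "\<exists>U V \<phi> \<psi>.
           p \<in> U \<and> U \<subseteq> D \<and> diffeomorphism U V \<phi> \<psi> \<and>
           principal_surface w V (z \<circ> \<psi>) (l \<circ> \<psi>) \<and>
           (\<forall>q\<in>V. mink (partial_x (z \<circ> \<psi>) q) (partial_x (z \<circ> \<psi>) q) = 1 / \<nu> (\<psi> q) \<and>
                  - mink (partial_y (z \<circ> \<psi>) q) (partial_y (z \<circ> \<psi>) q) = 1 / \<nu> (\<psi> q))"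
    using box xy p by (intro exI[of _ "?I \<times> ?I'"] exI[of _ "J \<times> K"] exI[of _ "map_prod A B"] exI[of _ ?\<psi>]) auto
qed

end
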